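(* Let $\lambda_1,\lambda_2,\lambda_3\in\mathbb{R}$. The ring $\mathbb{K}$ of 3-parameter generalized quaternions is isomorphic (as a ring) to a subring of the ring $\mathbb{M}_4(\mathbb{R})$ of real $4\times4$ matrices.
   Context: Given $\lambda_1,\lambda_2,\lambda_3\in\mathbb{R}$, $\mathbb{K}$ is the real vector space with basis $1,e_1,e_2,e_3$ with the bilinear multiplication for which $1$ is a unit and $e_1^2=-\lambda_1\lambda_2$, $e_2^2=-\lambda_1\lambda_3$, $e_3^2=-\lambda_2\lambda_3$, $e_1e_2=\lambda_1e_3=-e_2e_1$, $e_2e_3=\lambda_3e_1=-e_3e_2$, $e_3e_1=\lambda_2e_2=-e_1e_3$; it is a ring with unity under this multiplication. *)

theory Defs
  imports
    "HOL-Analysis.Finite_Cartesian_Product"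
    "HOL-Algebra.Subrings"
    "Jordan_Normal_Form.Matrix"
begin

text \<open>
  The underlying real vector space of the generalized quaternions is \<open>real ^ quat_basis\<close>;
  its basis vectors 1, e1, e2, e3 are \<open>axis E0 1\<close>, \<open>axis E1 1\<close>, \<open>axis E2 1\<close>, \<open>axis E3 1\<close>.
\<close>

datatype quat_basis = E0 | E1 | E2 | E3

lemma UNIV_quat_basis: "UNIV = {E0, E1, E2, E3}"
  using quat_basis.exhaust by auto

instance quat_basis :: finite
  by standard (simp add: UNIV_quat_basis)

lemma sum_quat_basis: "(\<Sum>i\<in>UNIV. f i) = f E0 + f E1 + f E2 + f E3"
  for f :: "quat_basis \<Rightarrow> 'a :: comm_monoid_add"
  by (simp add: UNIV_quat_basis add.assoc)

fun basis_mult :: "real \<Rightarrow> real \<Rightarrow> real \<Rightarrow> quat_basis \<Rightarrow> quat_basis \<Rightarrow> real ^ quat_basis" where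
  "basis_mult l1 l2 l3 E0 j = axis j 1"
| "basis_mult l1 l2 l3 i E0 = axis i 1"
| "basis_mult l1 l2 l3 E1 E1 = - (l1 * l2) *\<^sub>R axis E0 1"
| "basis_mult l1 l2 l3 E2 E2 = - (l1 * l3) *\<^sub>R axis E0 1"
| "basis_mult l1 l2 l3 E3 E3 = - (l2 * l3) *\<^sub>R axis E0 1"
| "basis_mult l1 l2 l3 E1 E2 = l1 *\<^sub>R axis E3 1"
| "basis_mult l1 l2 l3 E2 E1 = - l1 *\<^sub>R axis E3 1"
| "basis_mult l1 l2 l3 E2 E3 = l3 *\<^sub>R axis E1 1"
| "basis_mult l1 l2 l3 E3 E2 = - l3 *\<^sub>R axis E1 1"
| "basis_mult l1 l2 l3 E3 E1 = l2 *\<^sub>R axis E2 1"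
| "basis_mult l1 l2 l3 E1 E3 = - l2 *\<^sub>R axis E2 1"

text \<open>The bilinear extension of \<open>basis_mult\<close>.\<close>

definition quat_mult ::
  "real \<Rightarrow> real \<Rightarrow> real \<Rightarrow> real ^ quat_basis \<Rightarrow> real ^ quat_basis \<Rightarrow> real ^ quat_basis" where
  "quat_mult l1 l2 l3 x y =
     (\<Sum>i\<in>UNIV. \<Sum>j\<in>UNIV. (vec_nth x i * vec_nth y j) *\<^sub>R basis_mult l1 l2 l3 i j)"

definition gen_quat :: "real \<Rightarrow> real \<Rightarrow> real \<Rightarrow> (real ^ quat_basis) ring" where
  "gen_quat l1 l2 l3 =
     \<lparr>carrier = UNIV, monoid.mult = quat_mult l1 l2 l3, one = axis E0 1, zero = 0, add = (+)\<rparr>"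

lemma axis_one_nth: "vec_nth (axis i 1) j = (if i = j then 1 else (0 :: real))"
  by (simp add: axis_def)

lemma quat_mult_axis:
  "quat_mult l1 l2 l3 (axis i 1) (axis j 1) = basis_mult l1 l2 l3 i j"
  by (cases i; cases j) (simp_all add: quat_mult_def sum_quat_basis axis_one_nth)

lemma quat_mult_nth:
  "vec_nth (quat_mult l1 l2 l3 x y) E0 =
     vec_nth x E0 * vec_nth y E0 - l1 * l2 * (vec_nth x E1 * vec_nth y E1)
     - l1 * l3 * (vec_nth x E2 * vec_nth y E2) - l2 * l3 * (vec_nth x E3 * vec_nth y E3)"
  "vec_nth (quat_mult l1 l2 l3 x y) E1 =
     vec_nth x E0 * vec_nth y E1 + vec_nth x E1 * vec_nth y E0
     + l3 * (vec_nth x E2 * vec_nth y E3 - vec_nth x E3 * vec_nth y E2)"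
  "vec_nth (quat_mult l1 l2 l3 x y) E2 =
     vec_nth x E0 * vec_nth y E2 + vec_nth x E2 * vec_nth y E0
     + l2 * (vec_nth x E3 * vec_nth y E1 - vec_nth x E1 * vec_nth y E3)"
  "vec_nth (quat_mult l1 l2 l3 x y) E3 =
     vec_nth x E0 * vec_nth y E3 + vec_nth x E3 * vec_nth y E0
     + l1 * (vec_nth x E1 * vec_nth y E2 - vec_nth x E2 * vec_nth y E1)"
  by (simp_all add: quat_mult_def sum_quat_basis axis_one_nth right_diff_distrib)

lemma quat_eq_iff:
  "x = y \<longleftrightarrow> vec_nth x E0 = vec_nth y E0 \<and> vec_nth x E1 = vec_nth y E1 \<and>
     vec_nth x E2 = vec_nth y E2 \<and> vec_nth x E3 = vec_nth y E3"
  for x y :: "real ^ quat_basis"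
proof -
  have "(\<forall>i. P i) \<longleftrightarrow> P E0 \<and> P E1 \<and> P E2 \<and> P E3" for P
    using quat_basis.induct by blast
  from this[of "\<lambda>i. vec_nth x i = vec_nth y i"] show ?thesis unfolding Finite_Cartesian_Product.vec_eq_iff .
qed

lemma ring_gen_quat: "ring (gen_quat l1 l2 l3)"
proof (rule ringI)
  show "abelian_group (gen_quat l1 l2 l3)"
  proof (rule abelian_groupI, goal_cases)
    case (6 x)
    show ?case by (rule bexI[of _ "- x"]) (simp_all add: gen_quat_def)
  qed (simp_all add: gen_quat_def add.assoc add.commute)
  show "Group.monoid (gen_quat l1 l2 l3)"
  proof (rule monoidI, goal_cases)
    case (3 x y z)
    have "quat_mult l1 l2 l3 (quat_mult l1 l2 l3 x y) z =
        quat_mult l1 l2 l3 x (quat_mult l1 l2 l3 y z)"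
      unfolding quat_eq_iff quat_mult_nth by (simp add: ring_distribs mult_ac)
    then show ?case by (simp add: gen_quat_def)
  qed (simp_all add: gen_quat_def quat_eq_iff quat_mult_nth, simp_all add: axis_one_nth)
qed (simp_all add: gen_quat_def quat_eq_iff quat_mult_nth, simp_all add: algebra_simps)

end

theory Submission
  imports Defs
begin

text \<open>
  The proof is Cayley's theorem for algebras. Left multiplication \<open>x \<mapsto> a x\<close> by a generalized
  quaternion \<open>a\<close> is a real linear map of a 4-dimensional space, so it has a \<open>4 \<times> 4\<close> matrix
  \<open>left_mult_mat a\<close> with respect to the basis \<open>1, e1, e2, e3\<close>. Bilinearity of the product makes
  \<open>a \<mapsto> left_mult_mat a\<close> additive, associativity says that \<open>a b\<close> acts as \<open>b\<close> followed by \<open>a\<close>,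
  which is the product of the matrices, and the unit makes the map injective, since \<open>a\<close> can be
  read off from \<open>a 1 = a\<close>. Hence \<open>a \<mapsto> left_mult_mat a\<close> embeds the generalized quaternions
  into the matrix ring, and the subring is its image. Because injectivity rests on the unit alone,
  it holds even for degenerate parameters such as \<open>l1 = 0\<close>, where basis elements square to zero.
\<close>

text \<open>
  Matrices are indexed by \<open>0, \<dots>, 3\<close> while coordinates are indexed by the basis; this enumeration
  translates between the two and puts the unit in the first column.
\<close>

definition basis_enum :: "nat \<Rightarrow> quat_basis" where
  "basis_enum i = [E0, E1, E2, E3] ! i"

definition left_mult_mat ::
  "real \<Rightarrow> real \<Rightarrow> real \<Rightarrow> real ^ quat_basis \<Rightarrow> real mat" where
  "left_mult_mat l1 l2 l3 a =
     mat 4 4 (\<lambda>(i, j). vec_nth (quat_mult l1 l2 l3 a (axis (basis_enum j) 1)) (basis_enum i))"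

lemma sum_basis_enum: "(\<Sum>k<4. f (basis_enum k)) = (\<Sum>k\<in>UNIV. f k)"
  for f :: "quat_basis \<Rightarrow> 'a :: comm_monoid_add"
  by (simp add: sum_quat_basis basis_enum_def eval_nat_numeral add.assoc)

lemma quat_mult_assoc:
  "quat_mult l1 l2 l3 (quat_mult l1 l2 l3 x y) z = quat_mult l1 l2 l3 x (quat_mult l1 l2 l3 y z)"
proof -
  interpret ring "gen_quat l1 l2 l3" by (rule ring_gen_quat)
  show ?thesis using m_assoc[of x y z] by (simp add: gen_quat_def)
qed

lemma quat_mult_add_left:
  "quat_mult l1 l2 l3 (x + y) z = quat_mult l1 l2 l3 x z + quat_mult l1 l2 l3 y z"
proof -
  interpret ring "gen_quat l1 l2 l3" by (rule ring_gen_quat)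
  show ?thesis using l_distr[of x y z] by (simp add: gen_quat_def)
qed

lemma quat_mult_one_left: "quat_mult l1 l2 l3 (axis E0 1) x = x"
proof -
  interpret ring "gen_quat l1 l2 l3" by (rule ring_gen_quat)
  show ?thesis using l_one[of x] by (simp add: gen_quat_def)
qed

lemma quat_mult_one_right: "quat_mult l1 l2 l3 x (axis E0 1) = x"
proof -
  interpret ring "gen_quat l1 l2 l3" by (rule ring_gen_quat)
  show ?thesis using r_one[of x] by (simp add: gen_quat_def)
qed

text \<open>
  Left multiplication by \<open>a\<close> is linear, hence determined by its values on the basis; in
  coordinates this is the formula for applying a matrix to a vector.
\<close>

lemma quat_mult_nth_expand:
  "vec_nth (quat_mult l1 l2 l3 a y) i =
     (\<Sum>k\<in>UNIV. vec_nth (quat_mult l1 l2 l3 a (axis k 1)) i * vec_nth y k)"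
  by (cases i) (simp_all add: sum_quat_basis quat_mult_nth axis_one_nth algebra_simps)

lemma left_mult_mat_mult:
  "left_mult_mat l1 l2 l3 (quat_mult l1 l2 l3 a b) =
     left_mult_mat l1 l2 l3 a * left_mult_mat l1 l2 l3 b"
proof (rule eq_matI)
  fix i j
  assume "i < dim_row (left_mult_mat l1 l2 l3 a * left_mult_mat l1 l2 l3 b)"
    and "j < dim_col (left_mult_mat l1 l2 l3 a * left_mult_mat l1 l2 l3 b)"
  then have ij: "i < 4" "j < 4"
    by (simp_all add: left_mult_mat_def)
  let ?m = "quat_mult l1 l2 l3" and ?e = "\<lambda>k. axis k 1 :: real ^ quat_basis"
  have "left_mult_mat l1 l2 l3 (?m a b) $$ (i, j)
      = vec_nth (?m a (?m b (?e (basis_enum j)))) (basis_enum i)"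
    using ij by (simp add: left_mult_mat_def quat_mult_assoc)
  also have "\<dots> = (\<Sum>k\<in>UNIV. vec_nth (?m a (?e k)) (basis_enum i) *
      vec_nth (?m b (?e (basis_enum j))) k)"
    by (rule quat_mult_nth_expand)
  also have "\<dots> = (\<Sum>k<4. vec_nth (?m a (?e (basis_enum k))) (basis_enum i) *
      vec_nth (?m b (?e (basis_enum j))) (basis_enum k))"
    by (rule sum_basis_enum[symmetric])
  also have "\<dots> = (left_mult_mat l1 l2 l3 a * left_mult_mat l1 l2 l3 b) $$ (i, j)"
    using ij by (simp add: left_mult_mat_def scalar_prod_def atLeast0LessThan)
  finally show "left_mult_mat l1 l2 l3 (?m a b) $$ (i, j) =
      (left_mult_mat l1 l2 l3 a * left_mult_mat l1 l2 l3 b) $$ (i, j)" .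
qed (simp_all add: left_mult_mat_def)

lemma left_mult_mat_add:
  "left_mult_mat l1 l2 l3 (a + b) = left_mult_mat l1 l2 l3 a + left_mult_mat l1 l2 l3 b"
  by (rule eq_matI) (simp_all add: left_mult_mat_def quat_mult_add_left)

lemma left_mult_mat_one: "left_mult_mat l1 l2 l3 (axis E0 1) = 1\<^sub>m 4"
proof (rule eq_matI)
  fix i j :: nat
  assume "i < dim_row (1\<^sub>m 4 :: real mat)" "j < dim_col (1\<^sub>m 4 :: real mat)"
  then have ij: "i < 4" "j < 4" by simp_all
  moreover have "basis_enum j = basis_enum i \<longleftrightarrow> i = j"
    unfolding basis_enum_def using ij by (subst nth_eq_iff_index_eq) auto
  ultimately show "left_mult_mat l1 l2 l3 (axis E0 1) $$ (i, j) = 1\<^sub>m 4 $$ (i, j)"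
    by (simp add: left_mult_mat_def quat_mult_one_left axis_one_nth)
qed (simp_all add: left_mult_mat_def)

lemma left_mult_mat_first_column:
  "i < 4 \<Longrightarrow> left_mult_mat l1 l2 l3 a $$ (i, 0) = vec_nth a (basis_enum i)"
  by (simp add: left_mult_mat_def basis_enum_def[of 0] quat_mult_one_right)

lemma inj_left_mult_mat: "inj (left_mult_mat l1 l2 l3)"
proof (rule injI)
  fix a b
  assume "left_mult_mat l1 l2 l3 a = left_mult_mat l1 l2 l3 b"
  then have *: "vec_nth a (basis_enum i) = vec_nth b (basis_enum i)" if "i < 4" for i
    using left_mult_mat_first_column[OF that, of l1 l2 l3] by metis
  show "a = b"
    using *[of 0] *[of 1] *[of 2] *[of 3] by (simp add: quat_eq_iff basis_enum_def)
qed

lemma ring_hom_left_mult_mat: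
  "left_mult_mat l1 l2 l3 \<in> Ring.ring_hom (gen_quat l1 l2 l3) (ring_mat TYPE(real) 4 ())"
  by (rule ring_hom_memI)
    (simp_all add: gen_quat_def ring_mat_simps left_mult_mat_mult left_mult_mat_add
      left_mult_mat_one, simp add: left_mult_mat_def)

theorem theorem3p1:
  fixes l1 l2 l3 :: real
  shows "\<exists>S. subring S (ring_mat TYPE(real) 4 ()) \<and>
             gen_quat l1 l2 l3 \<simeq> (ring_mat TYPE(real) 4 ())\<lparr>carrier := S\<rparr>"
proof (intro exI conjI)
  let ?Q = "gen_quat l1 l2 l3" and ?M = "ring_mat TYPE(real) 4 ()"
    and ?h = "left_mult_mat l1 l2 l3"
  interpret ring_hom_ring ?Q ?M ?h
    using ring_hom_left_mult_mat
    by (intro ring_hom_ringI2 ring_gen_quat ring_mat)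
  show "subring (?h ` carrier ?Q) ?M"
    by (intro img_is_subring ring.carrier_is_subring ring_gen_quat)
  have "bij_betw ?h (carrier ?Q) (?h ` carrier ?Q)"
    by (rule inj_on_imp_bij_betw) (rule inj_on_subset[OF inj_left_mult_mat subset_UNIV])
  then have "?h \<in> ring_iso ?Q (?M\<lparr>carrier := ?h ` carrier ?Q\<rparr>)"
    using ring_hom_left_mult_mat by (auto simp: ring_iso_def Ring.ring_hom_def)
  then show "?Q \<simeq> ?M\<lparr>carrier := ?h ` carrier ?Q\<rparr>"
    unfolding is_ring_iso_def by blast
qed

end
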